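(* Let $d\ge1$, let $\|\cdot\|$ be a norm on $\mathbb{R}^d$, fix a time $t$ and a vector $\bar{\bm a}(t)\in\mathbb{R}_{\ge0}^d$. Let $F,G:\mathbb{R}_{\ge0}^d\to\mathbb{R}_{\ge0}^d$ and define $\Phi_t:\mathbb{R}_{\ge0}^d\to\mathbb{R}_{\ge0}^d$ by $\Phi_t(x)=G\big(F(\bar{\bm a}(t)+x)\big)$. Suppose: (i) $G$ is monotone and Lipschitz with constant $L_G\ge 0$ in $\|\cdot\|$; (ii) $F$ is monotone and Lipschitz with constant $L_F\ge 0$ in $\|\cdot\|$; (iii) $L_GL_F<1$. Then $\Phi_t$ is a contraction and has a unique fixed point $x^\star\in\mathbb{R}_{\ge0}^d$. Moreover, for any initial $x^{(0)}\in\mathbb{R}_{\ge0}^d$, the iteration $x^{(k+1)}=\Phi_t(x^{(k)})$, $k=0,1,2,\dots$, converges to $x^\star$ at a linear rate bounded by $L_GL_F$, i.e. $\|x^{(k+1)}-x^\star\|\le L_GL_F\,\|x^{(k)}-x^\star\|$ for all $k$.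
   Context: A map $\Psi:\mathbb{R}_{\ge0}^d\to\mathbb{R}_{\ge0}^d$ is monotone if $x\le y$ componentwise implies $\Psi(x)\le\Psi(y)$ componentwise. It is Lipschitz with constant $L$ in the norm $\|\cdot\|$ if $\|\Psi(x)-\Psi(y)\|\le L\|x-y\|$ for all $x,y\in\mathbb{R}_{\ge0}^d$. (Interpretation: $x$ is the stacked vector of inflow envelopes in a cyclic network of modules, $\bar{\bm a}(t)$ the stacked exogenous envelope, $F$ the map from assumed total envelopes to exported outflow envelopes, $G$ the interconnection map from outflow envelopes to inflow envelopes.) Contraction means Lipschitz with a constant strictly less than 1 in $\|\cdot\|$. *)

theory Defs
  imports "HOL-Analysis.Analysis"
begin

(* An arbitrary norm, given as an explicit function: the type class operation norm on
   real ^ 'n is always the Euclidean one.  For the same reason the library's lipschitz_on,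
   which refers to the type class metric, is not used below. *)
definition is_norm :: "(real ^ 'n \<Rightarrow> real) \<Rightarrow> bool" where
  "is_norm N \<longleftrightarrow>
     (\<forall>x. N x \<ge> 0) \<and>
     (\<forall>x. N x = 0 \<longleftrightarrow> x = 0) \<and>
     (\<forall>c x. N (c *\<^sub>R x) = \<bar>c\<bar> * N x) \<and>
     (\<forall>x y. N (x + y) \<le> N x + N y)"

definition nonneg_orthant :: "(real ^ 'n) set" where
  "nonneg_orthant = {x. \<forall>i. 0 \<le> x $ i}"

definition lipschitz_in_norm ::
    "(real ^ 'n \<Rightarrow> real) \<Rightarrow> real \<Rightarrow> (real ^ 'n) set \<Rightarrow> (real ^ 'n \<Rightarrow> real ^ 'n) \<Rightarrow> bool" where
  "lipschitz_in_norm N L S \<Psi> \<longleftrightarrow> (\<forall>x\<in>S. \<forall>y\<in>S. N (\<Psi> x - \<Psi> y) \<le> L * N (x - y))"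

definition contraction_in_norm ::
    "(real ^ 'n \<Rightarrow> real) \<Rightarrow> (real ^ 'n) set \<Rightarrow> (real ^ 'n \<Rightarrow> real ^ 'n) \<Rightarrow> bool" where
  "contraction_in_norm N S \<Psi> \<longleftrightarrow> (\<exists>L. 0 \<le> L \<and> L < 1 \<and> lipschitz_in_norm N L S \<Psi>)"

definition network_map ::
    "(real ^ 'n \<Rightarrow> real ^ 'n) \<Rightarrow> (real ^ 'n \<Rightarrow> real ^ 'n) \<Rightarrow> ('t \<Rightarrow> real ^ 'n) \<Rightarrow> 't
      \<Rightarrow> real ^ 'n \<Rightarrow> real ^ 'n" where
  "network_map G F abar t x = G (F (abar t + x))"

end

theory Submission
  imports Defs
begin

text \<open>
  A contraction for an arbitrary norm need not be one for the Euclidean norm, but norms on a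
  finite-dimensional space are equivalent, so some iterate of it is. Banach's theorem applied to
  that iterate gives a unique fixed point, which the original map permutes and hence fixes.
\<close>

text \<open>Expanding \<open>x\<close> in the standard basis, the triangle inequality and
  homogeneity bound \<open>N x\<close> by a weighted sum of absolute coordinates, each of which is
  at most the Euclidean norm. This is the easy half of norm equivalence.\<close>

lemma is_norm_upper_bound:
  fixes N :: "real ^ 'n \<Rightarrow> real"
  assumes "is_norm N"
  obtains C where "C > 0" "\<And>x. N x \<le> C * norm x"
proof
  have sum_le: "N (sum f A) \<le> (\<Sum>i\<in>A. N (f i))" if "finite A" for A and f :: "'n \<Rightarrow> real ^ 'n"
    using that
  proof (induction A rule: finite_induct)
    case empty
    have "N 0 = 0" using assms unfolding is_norm_def by blast
    then show ?case by simp
  next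
    case (insert a A)
    have "N (f a + sum f A) \<le> N (f a) + N (sum f A)"
      using assms by (auto simp: is_norm_def)
    with insert show ?case by simp
  qed
  let ?C = "\<Sum>i\<in>UNIV. N (axis i 1)"
  have nn: "0 \<le> N y" for y
    using assms by (auto simp: is_norm_def)
  \<comment> \<open>The extra 1 yields a strictly positive constant from nonnegativity of the
    summands alone.\<close>
  show "0 < ?C + 1"
    by (simp add: add_nonneg_pos sum_nonneg nn)
  show "N x \<le> (?C + 1) * norm x" for x
  proof -
    have "N x = N (\<Sum>i\<in>UNIV. x $ i *\<^sub>R axis i 1)"
      by (simp add: basis_expansion scalar_mult_eq_scaleR[symmetric])
    also have "\<dots> \<le> (\<Sum>i\<in>UNIV. N (x $ i *\<^sub>R axis i 1))"
      by (rule sum_le) simp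
    also have "\<dots> = (\<Sum>i\<in>UNIV. \<bar>x $ i\<bar> * N (axis i 1))"
      using assms by (simp add: is_norm_def)
    also have "\<dots> \<le> (\<Sum>i\<in>UNIV. norm x * N (axis i 1))"
      by (intro sum_mono mult_right_mono nn component_le_norm_cart)
    also have "\<dots> = ?C * norm x"
      by (simp add: sum_distrib_left mult.commute)
    also have "\<dots> \<le> (?C + 1) * norm x"
      by (simp add: mult_right_mono)
    finally show ?thesis .
  qed
qed

lemma is_norm_diff_commute:
  assumes "is_norm N"
  shows "N (x - y) = N (y - x)"
proof -
  have "N ((- 1) *\<^sub>R (y - x)) = \<bar>- 1\<bar> * N (y - x)"
    using assms unfolding is_norm_def by blast
  then show ?thesis by simp
qed

text \<open>The reverse triangle inequality and the upper bound make \<open>N\<close> Lipschitz for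
  the Euclidean metric. Continuity is what allows a minimum to be taken over a compact set.\<close>

lemma is_norm_continuous_on:
  fixes N :: "real ^ 'n \<Rightarrow> real"
  assumes "is_norm N"
  shows "continuous_on S N"
proof -
  obtain C where C: "C > 0" "\<And>x. N x \<le> C * norm x"
    using is_norm_upper_bound[OF assms] by blast
  have le: "N x - N y \<le> N (x - y)" for x y
  proof -
    have "N ((x - y) + y) \<le> N (x - y) + N y"
      using assms unfolding is_norm_def by blast
    then show ?thesis by simp
  qed
  have "dist (N x) (N y) \<le> C * dist x y" for x y
    using le[of x y] le[of y x] is_norm_diff_commute[OF assms, of x y] C(2)[of "x - y"]
    by (simp add: dist_norm)
  then have "C-lipschitz_on S N"
    using C(1) by (intro lipschitz_onI) auto
  then show ?thesis
    by (rule lipschitz_on_continuous_on)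
qed

text \<open>On the compact Euclidean unit sphere \<open>N\<close> attains a minimum, which is
  positive because the minimizer is nonzero. That minimum serves as \<open>c\<close>, and
  homogeneity carries the bound from the sphere to all vectors.\<close>

lemma is_norm_lower_bound:
  fixes N :: "real ^ 'n \<Rightarrow> real"
  assumes "is_norm N"
  obtains c where "c > 0" "\<And>x. c * norm x \<le> N x"
proof -
  \<comment> \<open>The minimum exists only on a nonempty sphere; \<open>undefined\<close> serves as
    an arbitrary index, since any basis vector will do.\<close>
  have "axis undefined 1 \<in> sphere (0 :: real ^ 'n) 1"
    by simp
  then obtain u where u: "u \<in> sphere 0 1" "\<And>y. y \<in> sphere 0 1 \<Longrightarrow> N u \<le> N y"
    using continuous_attains_inf[OF compact_sphere _ is_norm_continuous_on[OF assms]]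
    by blast
  show ?thesis
  proof
    have "u \<noteq> 0" using u(1) by auto
    then show "N u > 0"
      using assms unfolding is_norm_def by (metis order_le_less)
    show "N u * norm x \<le> N x" for x
    proof (cases "x = 0")
      case True
      then show ?thesis using assms by (simp add: is_norm_def)
    next
      case False
      have "N u \<le> N ((1 / norm x) *\<^sub>R x)"
        using False by (intro u(2)) simp
      also have "\<dots> = N x / norm x"
        using assms by (simp add: is_norm_def)
      finally show ?thesis
        using False by (simp add: field_simps)
    qed
  qed
qed

lemma lipschitz_in_norm_compose:
  assumes "lipschitz_in_norm N L T g" "lipschitz_in_norm N M S f" "f ` S \<subseteq> T" "0 \<le> L"
  shows "lipschitz_in_norm N (L * M) S (g \<circ> f)"
  unfolding lipschitz_in_norm_def
proof (intro ballI)
  fix x y assume xy: "x \<in> S" "y \<in> S"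
  have "N (g (f x) - g (f y)) \<le> L * N (f x - f y)"
    using assms(1,3) xy by (auto simp: lipschitz_in_norm_def)
  also have "\<dots> \<le> L * (M * N (x - y))"
    using assms(2,4) xy by (auto simp: lipschitz_in_norm_def intro: mult_left_mono)
  finally show "N ((g \<circ> f) x - (g \<circ> f) y) \<le> L * M * N (x - y)"
    by (simp add: mult.assoc)
qed

lemma funpow_image_subset:
  assumes "f ` S \<subseteq> S"
  shows "(f ^^ m) ` S \<subseteq> S"
  using assms by (induction m) auto

text \<open>Constants multiply under composition. Hence for \<open>L < 1\<close> the iterates have
  arbitrarily small constants.\<close>

lemma lipschitz_in_norm_funpow:
  assumes "lipschitz_in_norm N L S f" "f ` S \<subseteq> S" "0 \<le> L"
  shows "lipschitz_in_norm N (L ^ m) S (f ^^ m)"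
proof (induction m)
  case 0
  then show ?case by (simp add: lipschitz_in_norm_def)
next
  case (Suc m)
  have "lipschitz_in_norm N (L * L ^ m) S (f \<circ> (f ^^ m))"
    by (rule lipschitz_in_norm_compose[OF assms(1) Suc funpow_image_subset[OF assms(2)] assms(3)])
  then show ?case by (simp add: comp_def)
qed

lemma fixed_point_of_contraction_in_norm:
  fixes N :: "real ^ 'n \<Rightarrow> real"
  assumes N: "is_norm N"
    and S: "closed S" "S \<noteq> {}" "f ` S \<subseteq> S"
    and f: "contraction_in_norm N S f"
  shows "\<exists>!x. x \<in> S \<and> f x = x"
proof -
  obtain L where L: "0 \<le> L" "L < 1" "lipschitz_in_norm N L S f"
    using f by (auto simp: contraction_in_norm_def)
  obtain c where c: "c > 0" "\<And>x. c * norm x \<le> N x"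
    using is_norm_lower_bound[OF N] by blast
  obtain C where C: "C > 0" "\<And>x. N x \<le> C * norm x"
    using is_norm_upper_bound[OF N] by blast
  \<comment> \<open>Passing from the Euclidean norm to \<open>N\<close> and back costs the factor
    \<open>C / c\<close>, which does not depend on the exponent. A large enough power of
    \<open>L\<close> outweighs it.\<close>
  obtain m where m: "L ^ m < c / C"
    using real_arch_pow_inv[of "c / C" L] c C L by auto
  let ?q = "C / c * L ^ m"
  have "dist ((f ^^ m) x) ((f ^^ m) y) \<le> ?q * dist x y" if "x \<in> S" "y \<in> S" for x y
  proof -
    have "c * norm ((f ^^ m) x - (f ^^ m) y) \<le> N ((f ^^ m) x - (f ^^ m) y)"
      by (rule c(2))
    also have "\<dots> \<le> L ^ m * N (x - y)"
      using lipschitz_in_norm_funpow[OF L(3) S(3) L(1)] that by (auto simp: lipschitz_in_norm_def)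
    also have "\<dots> \<le> L ^ m * (C * norm (x - y))"
      using L(1) by (intro mult_left_mono C(2)) simp
    finally show ?thesis
      using c(1) by (simp add: dist_norm field_simps)
  qed
  moreover have "0 \<le> ?q" "?q < 1"
    using c C L m by (simp_all add: field_simps)
  ultimately have ex1: "\<exists>!x\<in>S. (f ^^ m) x = x"
    using S(1,2) funpow_image_subset[OF S(3)]
    by (intro Banach_fix[where c = ?q]) (auto simp: complete_eq_closed)
  then obtain x where x: "x \<in> S" "(f ^^ m) x = x"
    by blast
  \<comment> \<open>Since \<open>f\<close> commutes with its iterates, it maps fixed points of
    \<open>f ^^ m\<close> to such points; by uniqueness \<open>f x\<close> must be
    \<open>x\<close>.\<close>
  have "(f ^^ m) (f x) = f x"
    using x(2) by (metis funpow_swap1)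
  moreover have "f x \<in> S"
    using S(3) x(1) by blast
  ultimately have "f x = x"
    using ex1 x by blast
  \<comment> \<open>A fixed point of \<open>f\<close> is also one of \<open>f ^^ m\<close>, so
    uniqueness transfers back to \<open>f\<close>.\<close>
  moreover have "y = x" if "y \<in> S" "f y = y" for y
  proof -
    have "(f ^^ m) y = y"
      using that(2) by (induction m) auto
    with that(1) x ex1 show ?thesis by blast
  qed
  ultimately show ?thesis
    using x(1) by blast
qed

text \<open>An intersection of closed half-spaces. Closedness supplies the completeness that
  Banach's theorem requires.\<close>

lemma closed_nonneg_orthant: "closed (nonneg_orthant :: (real ^ 'n) set)"
  unfolding nonneg_orthant_def
  by (intro closed_Collect_all closed_Collect_le continuous_intros)

text \<open>Iterating the one-step bound squeezes \<open>e k\<close> between 0 and the geometric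
  sequence \<open>q ^ k * e 0\<close>.\<close>

lemma linear_rate_tendsto_zero:
  fixes e :: "nat \<Rightarrow> real"
  assumes "\<And>k. 0 \<le> e k" "\<And>k. e (Suc k) \<le> q * e k" "0 \<le> q" "q < 1"
  shows "e \<longlonglongrightarrow> 0"
proof (rule tendsto_sandwich[where f = "\<lambda>_. 0" and h = "\<lambda>k. q ^ k * e 0"])
  have "e k \<le> q ^ k * e 0" for k
  proof (induction k)
    case (Suc k)
    have "e (Suc k) \<le> q * e k" by (rule assms)
    also have "\<dots> \<le> q * (q ^ k * e 0)"
      using Suc assms(3) by (rule mult_left_mono)
    finally show ?case by (simp add: mult.assoc)
  qed simp
  then show "\<forall>\<^sub>F k in sequentially. e k \<le> q ^ k * e 0"
    by simp
  show "(\<lambda>k. q ^ k * e 0) \<longlonglongrightarrow> 0"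
    using assms(3,4) by (intro tendsto_mult_left_zero LIMSEQ_power_zero) simp
qed (use assms(1) in simp_all)

theorem theorem6:
  fixes N :: "real ^ 'n \<Rightarrow> real"
    and abar :: "'t \<Rightarrow> real ^ 'n" and t :: 't
    and F G :: "real ^ 'n \<Rightarrow> real ^ 'n"
    and L\<^sub>F L\<^sub>G :: real
  defines "\<Phi> \<equiv> network_map G F abar t"
  assumes "is_norm N"
    and "abar t \<in> nonneg_orthant"
    and "F ` nonneg_orthant \<subseteq> nonneg_orthant"
    and "G ` nonneg_orthant \<subseteq> nonneg_orthant"
    and "mono_on nonneg_orthant G" and "0 \<le> L\<^sub>G" and "lipschitz_in_norm N L\<^sub>G nonneg_orthant G"
    and "mono_on nonneg_orthant F" and "0 \<le> L\<^sub>F" and "lipschitz_in_norm N L\<^sub>F nonneg_orthant F"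
    and "L\<^sub>G * L\<^sub>F < 1"
  shows "\<Phi> ` nonneg_orthant \<subseteq> nonneg_orthant \<and>
         contraction_in_norm N nonneg_orthant \<Phi> \<and>
         (\<exists>!xstar. xstar \<in> nonneg_orthant \<and> \<Phi> xstar = xstar) \<and>
         (\<forall>xstar\<in>nonneg_orthant. \<Phi> xstar = xstar \<longrightarrow>
            (\<forall>x :: nat \<Rightarrow> real ^ 'n.
               x 0 \<in> nonneg_orthant \<and> (\<forall>k. x (Suc k) = \<Phi> (x k)) \<longrightarrow>
                 (\<lambda>k. N (x k - xstar)) \<longlonglongrightarrow> 0 \<and>
                 (\<forall>k. N (x (Suc k) - xstar) \<le> L\<^sub>G * L\<^sub>F * N (x k - xstar))))"
proof -
  let ?S = "nonneg_orthant :: (real ^ 'n) set"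
  let ?q = "L\<^sub>G * L\<^sub>F"
  have q: "0 \<le> ?q" "?q < 1"
    using assms by simp_all
  have shift: "(\<lambda>x. abar t + x) ` ?S \<subseteq> ?S"
    using \<open>abar t \<in> ?S\<close> by (auto simp: nonneg_orthant_def)
  \<comment> \<open>With the shift by \<open>abar t\<close> as a separate factor, the composition
    lemma applies twice. A translation preserves differences, so it contributes the constant 1 and
    the product remains \<open>L\<^sub>G * L\<^sub>F\<close>.\<close>
  have Phi_eq: "\<Phi> = G \<circ> (F \<circ> (\<lambda>x. abar t + x))"
    by (auto simp: \<Phi>_def network_map_def)
  have inner: "(F \<circ> (\<lambda>x. abar t + x)) ` ?S \<subseteq> ?S"
    using shift \<open>F ` ?S \<subseteq> ?S\<close> unfolding image_comp[symmetric] by blast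
  have maps: "\<Phi> ` ?S \<subseteq> ?S"
    using inner \<open>G ` ?S \<subseteq> ?S\<close> unfolding Phi_eq image_comp[symmetric] by blast
  have "lipschitz_in_norm N 1 ?S (\<lambda>x. abar t + x)"
    by (simp add: lipschitz_in_norm_def)
  then have "lipschitz_in_norm N (L\<^sub>F * 1) ?S (F \<circ> (\<lambda>x. abar t + x))"
    using \<open>lipschitz_in_norm N L\<^sub>F ?S F\<close> shift \<open>0 \<le> L\<^sub>F\<close>
    by (intro lipschitz_in_norm_compose)
  from lipschitz_in_norm_compose[OF \<open>lipschitz_in_norm N L\<^sub>G ?S G\<close> this inner \<open>0 \<le> L\<^sub>G\<close>]
  have lip: "lipschitz_in_norm N ?q ?S \<Phi>"
    by (simp add: Phi_eq)
  have contr: "contraction_in_norm N ?S \<Phi>"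
    unfolding contraction_in_norm_def using q lip by blast
  have "0 \<in> ?S"
    by (simp add: nonneg_orthant_def)
  then have fixp: "\<exists>!xstar. xstar \<in> ?S \<and> \<Phi> xstar = xstar"
    by (intro fixed_point_of_contraction_in_norm[OF \<open>is_norm N\<close> closed_nonneg_orthant _ maps contr])
      blast
  have rate: "(\<lambda>k. N (x k - p)) \<longlonglongrightarrow> 0 \<and> (\<forall>k. N (x (Suc k) - p) \<le> ?q * N (x k - p))"
    if p: "p \<in> ?S" "\<Phi> p = p" and x: "x 0 \<in> ?S" "\<forall>k. x (Suc k) = \<Phi> (x k)"
    for p and x :: "nat \<Rightarrow> real ^ 'n"
  proof -
    \<comment> \<open>The Lipschitz bound holds only on the orthant, so the whole orbit must stay
      there.\<close>
    have xS: "x k \<in> ?S" for k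
      by (induction k) (use x maps in auto)
    \<comment> \<open>This is the Lipschitz bound at the pair \<open>x k\<close>, \<open>p\<close>,
      with \<open>\<Phi> p\<close> replaced by \<open>p\<close>.\<close>
    have step: "N (x (Suc k) - p) \<le> ?q * N (x k - p)" for k
      using lip xS[of k] p x(2) unfolding lipschitz_in_norm_def by metis
    moreover have "(\<lambda>k. N (x k - p)) \<longlonglongrightarrow> 0"
    proof (rule linear_rate_tendsto_zero[where q = ?q])
      show "0 \<le> N (x k - p)" for k
        using \<open>is_norm N\<close> by (simp add: is_norm_def)
    qed (use step q in auto)
    ultimately show ?thesis by blast
  qed
  show ?thesis
    using maps contr fixp rate by blast
qed

end
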